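(* Let $\mathbb D=\{z\in\mathbb C:|z|<1\}$. For a vector $(\alpha,\beta)\in\mathbb C^2$ the following are equivalent: (i) there exists a harmonic map $f\colon\mathbb D\to\mathbb D$ with $f(0)=0$, $\partial f(0)=\alpha$, and $\bar\partial f(0)=\beta$; (ii) there exists a harmonic map $f\colon\mathbb D\to\mathbb D$ with $\partial f(0)=\alpha$ and $\bar\partial f(0)=\beta$; (iii) $\|(\alpha,\beta)\|_{H^1_*}\le 1$.
   Context: A harmonic map $f\colon\mathbb D\to\mathbb D$ is a complex-valued function with values in $\mathbb D$ satisfying the Laplace equation $\partial\bar\partial f=0$ on $\mathbb D$, where the Wirtinger derivatives are $\partial f=\frac12\left(\frac{\partial f}{\partial x}-i\frac{\partial f}{\partial y}\right)$ and $\bar\partial f=\frac12\left(\frac{\partial f}{\partial x}+i\frac{\partial f}{\partial y}\right)$. For $(a_1,a_2)\in\mathbb C^2$ the Hardy norm is $\|(a_1,a_2)\|_{H^1}=\frac1{2\pi}\int_0^{2\pi}|a_1+a_2e^{it}|\,dt$. Its dual norm on $\mathbb C^2$ is $\|\xi\|_{H^1_*}=\sup\{|\langle\xi,\eta\rangle| : \eta\in\mathbb C^2,\ \|\eta\|_{H^1}\le 1\}$, where $\langle\xi,\eta\rangle=\xi_1\overline{\eta_1}+\xi_2\overline{\eta_2}$. *)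

theory Defs
  imports "HOL-Analysis.Analysis"
begin

definition partial_x :: "(complex \<Rightarrow> complex) \<Rightarrow> complex \<Rightarrow> complex" where
  "partial_x f z = vector_derivative (\<lambda>t::real. f (z + of_real t)) (at 0)"

definition partial_y :: "(complex \<Rightarrow> complex) \<Rightarrow> complex \<Rightarrow> complex" where
  "partial_y f z = vector_derivative (\<lambda>t::real. f (z + \<i> * of_real t)) (at 0)"

definition wirtinger :: "(complex \<Rightarrow> complex) \<Rightarrow> complex \<Rightarrow> complex" where
  "wirtinger f z = (1/2) * (partial_x f z - \<i> * partial_y f z)"

definition wirtinger_bar :: "(complex \<Rightarrow> complex) \<Rightarrow> complex \<Rightarrow> complex" where
  "wirtinger_bar f z = (1/2) * (partial_x f z + \<i> * partial_y f z)"

text \<open>Real continuous differentiability on an open set of the plane. Existence of the partial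
  derivatives is required explicitly, because \<^const>\<open>vector_derivative\<close> is total and has an
  unspecified value where no derivative exists.\<close>

definition C1_plane_on :: "(complex \<Rightarrow> complex) \<Rightarrow> complex set \<Rightarrow> bool" where
  "C1_plane_on f S \<longleftrightarrow>
     (\<forall>z\<in>S. (\<lambda>t::real. f (z + of_real t)) differentiable (at 0)
           \<and> (\<lambda>t::real. f (z + \<i> * of_real t)) differentiable (at 0))
     \<and> continuous_on S (partial_x f) \<and> continuous_on S (partial_y f)"

definition C2_plane_on :: "(complex \<Rightarrow> complex) \<Rightarrow> complex set \<Rightarrow> bool" where
  "C2_plane_on f S \<longleftrightarrow>
     C1_plane_on f S \<and> C1_plane_on (partial_x f) S \<and> C1_plane_on (partial_y f) S"

text \<open>The Laplace equation is understood classically, for twice continuously differentiable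
  functions. The set \<open>S\<close> is meant to be open.\<close>

definition harmonic_on :: "(complex \<Rightarrow> complex) \<Rightarrow> complex set \<Rightarrow> bool" where
  "harmonic_on f S \<longleftrightarrow> C2_plane_on f S \<and> (\<forall>z\<in>S. wirtinger (wirtinger_bar f) z = 0)"

abbreviation unit_disc :: "complex set" where
  "unit_disc \<equiv> ball 0 1"

definition harmonic_disc_map :: "(complex \<Rightarrow> complex) \<Rightarrow> bool" where
  "harmonic_disc_map f \<longleftrightarrow> harmonic_on f unit_disc \<and> f ` unit_disc \<subseteq> unit_disc"

definition hardy_norm :: "complex \<times> complex \<Rightarrow> real" where
  "hardy_norm a = 1 / (2 * pi) * integral {0..2 * pi} (\<lambda>t. cmod (fst a + snd a * exp (\<i> * of_real t)))"

definition hermitian_pairing :: "complex \<times> complex \<Rightarrow> complex \<times> complex \<Rightarrow> complex" where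
  "hermitian_pairing \<xi> \<eta> = fst \<xi> * cnj (fst \<eta>) + snd \<xi> * cnj (snd \<eta>)"

definition hardy_dual_norm :: "complex \<times> complex \<Rightarrow> real" where
  "hardy_dual_norm \<xi> = Sup {cmod (hermitian_pairing \<xi> \<eta>) | \<eta>. hardy_norm \<eta> \<le> 1}"

text \<open>The set in \<^const>\<open>hardy_dual_norm\<close> is nonempty and bounded above, so the real
  supremum is a genuine one.\<close>

lemma exp_has_integral_circle:
  "((\<lambda>t. exp (\<i> * of_real t)) has_integral 0) {0..2 * pi}"
proof -
  have "((\<lambda>t. exp (\<i> * of_real t)) has_integral
      (- \<i> * exp (\<i> * of_real (2 * pi)) - (- \<i> * exp (\<i> * of_real 0)))) {0..2 * pi}"
  proof (rule fundamental_theorem_of_calculus)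
    fix t :: real
    show "((\<lambda>t. - \<i> * exp (\<i> * of_real t)) has_vector_derivative exp (\<i> * of_real t)) (at t within {0..2 * pi})"
      by (rule has_vector_derivative_real_field[where f = "\<lambda>z. - \<i> * exp (\<i> * z)"])
         (auto intro!: derivative_eq_intros simp: mult.assoc)
  qed simp
  moreover have "exp (\<i> * of_real (2 * pi)) = 1"
    using exp_two_pi_i by (simp add: mult_ac)
  ultimately show ?thesis by simp
qed

lemma cmod_le_hardy_norm:
  "cmod a1 \<le> hardy_norm (a1, a2)" "cmod a2 \<le> hardy_norm (a1, a2)"
proof -
  define I where "I = integral {0..2 * pi} (\<lambda>t. cmod (a1 + a2 * exp (\<i> * of_real t)))"
  have int: "(\<lambda>t::real. cmod (a1 + a2 * exp (\<i> * of_real t))) integrable_on {0..2 * pi}"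
    by (intro integrable_continuous_real continuous_intros)
  have const: "((\<lambda>t. c) has_integral of_real (2 * pi) * c) {0..2 * pi}" for c :: complex
    using has_integral_const_real[of c 0 "2 * pi"] by (simp add: scaleR_conv_of_real)
  have bound: "2 * pi * cmod c \<le> I"
    if "(g has_integral of_real (2 * pi) * c) {0..2 * pi}"
      and "\<And>t. cmod (g t) \<le> cmod (a1 + a2 * exp (\<i> * of_real t))" for g c
  proof -
    have "cmod (integral {0..2 * pi} g) \<le> I"
      unfolding I_def using that int by (intro integral_norm_bound_integral) auto
    then show ?thesis
      using that(1) by (simp add: integral_unique norm_mult)
  qed
  have conv: "cmod c \<le> hardy_norm (a1, a2)" if "2 * pi * cmod c \<le> I" for c
    using that by (simp add: hardy_norm_def I_def field_simps)
  have "((\<lambda>t. a1 + a2 * exp (\<i> * of_real t)) has_integral of_real (2 * pi) * a1 + a2 * 0) {0..2 * pi}"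
    by (intro has_integral_add const has_integral_mult_right exp_has_integral_circle)
  then show "cmod a1 \<le> hardy_norm (a1, a2)"
    by (intro conv bound) auto
  have cnj_int: "((\<lambda>t. exp (- (\<i> * of_real t))) has_integral 0) {0..2 * pi}"
    using has_integral_cnj[THEN iffD2, OF exp_has_integral_circle]
    by (simp add: o_def exp_cnj)
  have "((\<lambda>t. a2 + a1 * exp (- (\<i> * of_real t))) has_integral of_real (2 * pi) * a2 + a1 * 0) {0..2 * pi}"
    by (intro has_integral_add const has_integral_mult_right cnj_int)
  moreover have "cmod (a2 + a1 * exp (- (\<i> * of_real t))) \<le> cmod (a1 + a2 * exp (\<i> * of_real t))" for t
  proof -
    have "a2 + a1 * exp (- (\<i> * of_real t)) = exp (- (\<i> * of_real t)) * (a1 + a2 * exp (\<i> * of_real t))"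
      by (simp add: algebra_simps flip: exp_add)
    then show ?thesis by (simp add: norm_mult)
  qed
  ultimately show "cmod a2 \<le> hardy_norm (a1, a2)"
    by (intro conv bound) auto
qed

lemma hardy_dual_norm_set:
  "{cmod (hermitian_pairing \<xi> \<eta>) | \<eta>. hardy_norm \<eta> \<le> 1} \<noteq> {}"
  "bdd_above {cmod (hermitian_pairing \<xi> \<eta>) | \<eta>. hardy_norm \<eta> \<le> 1}"
proof -
  have "hardy_norm (0, 0) \<le> 1" by (simp add: hardy_norm_def)
  then show "{cmod (hermitian_pairing \<xi> \<eta>) | \<eta>. hardy_norm \<eta> \<le> 1} \<noteq> {}" by blast
  have "cmod (hermitian_pairing \<xi> \<eta>) \<le> cmod (fst \<xi>) + cmod (snd \<xi>)" if "hardy_norm \<eta> \<le> 1" for \<eta>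
  proof -
    have "cmod (fst \<eta>) \<le> 1" "cmod (snd \<eta>) \<le> 1"
      using cmod_le_hardy_norm(1)[of "fst \<eta>" "snd \<eta>"]
        cmod_le_hardy_norm(2)[of "snd \<eta>" "fst \<eta>"] that by auto
    then have "cmod (fst \<xi> * cnj (fst \<eta>)) \<le> cmod (fst \<xi>)" "cmod (snd \<xi> * cnj (snd \<eta>)) \<le> cmod (snd \<xi>)"
      by (simp_all add: norm_mult mult_left_le)
    then show ?thesis
      unfolding hermitian_pairing_def by (intro norm_triangle_mono)
  qed
  then show "bdd_above {cmod (hermitian_pairing \<xi> \<eta>) | \<eta>. hardy_norm \<eta> \<le> 1}"
    by (auto simp: bdd_above_def)
qed

end

theory Submission
  imports Defs "HOL-Complex_Analysis.Complex_Analysis"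
begin

text \<open>A harmonic map of the disc is \<open>F + cnj G\<close> with \<open>F\<close>, \<open>G\<close> holomorphic, so its Wirtinger
  derivatives at \<open>0\<close> are the Fourier coefficients of index \<open>1\<close> and \<open>-1\<close> on small circles. Pairing
  them with \<open>(a, b)\<close> averages \<open>f\<close> against a trigonometric polynomial with \<open>L\<^sup>1\<close> norm equal
  to the Hardy norm of \<open>(a, b)\<close>, which bounds the dual norm by \<open>1\<close>.

  Conversely, let \<open>\<eta> = (a, b)\<close> maximise the pairing with \<open>\<xi> = (\<alpha>, \<beta>)\<close> over the unit ball of the
  Hardy norm, with maximum \<open>m \<le> 1\<close>. The Hardy norm is differentiable at \<open>\<eta>\<close>, because
  \<open>a + b e\<^sup>i\<^sup>t\<close> vanishes only on a null set, so maximality makes \<open>\<xi>\<close> equal to \<open>m\<close> times the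
  gradient of the norm. This says that \<open>\<alpha>\<close> and \<open>\<beta>\<close> are Fourier coefficients of
  \<open>m sgn (a + b e\<^sup>i\<^sup>t)\<close>, and the Poisson extension of the corresponding odd boundary function is the
  required map.\<close>

subsection \<open>Harmonic functions as sums of holomorphic and antiholomorphic functions\<close>

lemma C1_plane_on_has_vector_derivative:
  assumes "C1_plane_on f S" "z \<in> S"
  shows "((\<lambda>t::real. f (z + of_real t)) has_vector_derivative partial_x f z) (at 0)"
    and "((\<lambda>t::real. f (z + \<i> * of_real t)) has_vector_derivative partial_y f z) (at 0)"
  using assms unfolding C1_plane_on_def partial_x_def partial_y_def
  by (auto simp: vector_derivative_works)

text \<open>Continuous partial derivatives make \<open>g\<close> real differentiable at
  \<open>z\<close>. The vanishing of \<open>wirtinger_bar g z\<close> is the Cauchy-Riemann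
  equation, which makes the real derivative complex linear.\<close>

lemma C1_plane_on_Cauchy_Riemann:
  assumes S: "open S" and C1: "C1_plane_on g S" and z: "z \<in> S"
    and CR: "wirtinger_bar g z = 0"
  shows "(g has_field_derivative wirtinger g z) (at z)"
proof -
  obtain e where e: "e > 0" "ball z e \<subseteq> S"
    using S z open_contains_ball by blast
  \<comment> \<open>With half-width \<open>e/2\<close> in each coordinate, the two deviations from
    \<open>z\<close> add up to less than \<open>e\<close>, so the rectangle stays inside
    \<open>ball z e\<close>.\<close>
  define X where "X = {Re z - e/2<..<Re z + e/2}"
  define Y where "Y = {Im z - e/2<..<Im z + e/2}"
  define h where "h = (\<lambda>x y :: real. g (of_real x + \<i> * of_real y))"
  have XY: "of_real x + \<i> * of_real y \<in> S" if "x \<in> X" "y \<in> Y" for x y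
  proof -
    have "cmod (z - (of_real x + \<i> * of_real y))
        \<le> \<bar>Re z - x\<bar> + \<bar>Im z - y\<bar>"
      using cmod_le[of "z - (of_real x + \<i> * of_real y)"] by simp
    also have "\<dots> < e" using that by (auto simp: X_def Y_def abs_if)
    finally show ?thesis using e by (auto simp: dist_norm)
  qed
  have zXY: "Re z \<in> X" "Im z \<in> Y" using e by (auto simp: X_def Y_def)
  have z_eq: "of_real (Re z) + \<i> * of_real (Im z) = z" by (simp add: complex_eq_iff)
  have dx: "((\<lambda>t::real. g (w + of_real t)) has_vector_derivative partial_x g w) (at 0)"
    and dy: "((\<lambda>t::real. g (w + \<i> * of_real t)) has_vector_derivative partial_y g w) (at 0)"
    if "w \<in> S" for w
    using C1_plane_on_has_vector_derivative[OF C1 that] .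
  \<comment> \<open>The two variables are treated differently: the \<open>x\<close>-derivative is
    needed only at \<open>z\<close>, while the \<open>y\<close>-derivative is needed on the whole
    rectangle and must be continuous at \<open>z\<close>.\<close>
  have hx: "((\<lambda>x. h x (Im z)) has_derivative (\<lambda>t. t *\<^sub>R partial_x g z)) (at (Re z) within X)"
  proof -
    have "((\<lambda>t. g (z + of_real t)) \<circ> (\<lambda>x. x - Re z) has_vector_derivative 1 *\<^sub>R partial_x g z) (at (Re z))"
      using dx[OF z] by (intro vector_diff_chain_at) (auto intro!: derivative_eq_intros)
    moreover have "(\<lambda>t. g (z + of_real t)) \<circ> (\<lambda>x. x - Re z) = (\<lambda>x. h x (Im z))"
      unfolding h_def o_def by (intro ext arg_cong[where f = g]) (simp add: complex_eq_iff)
    ultimately show ?thesis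
      by (auto simp: has_vector_derivative_def intro: has_derivative_at_withinI)
  qed
  have hy: "(h x has_derivative blinfun_apply (blinfun_scaleR_left (partial_y g (of_real x + \<i> * of_real y))))
      (at y within Y)" if "x \<in> X" "y \<in> Y" for x y
  proof -
    let ?w = "of_real x + \<i> * of_real y :: complex"
    have "((\<lambda>t. g (?w + \<i> * of_real t)) \<circ> (\<lambda>t. t - y) has_vector_derivative 1 *\<^sub>R partial_y g ?w) (at y)"
      using dy[OF XY[OF that]] by (intro vector_diff_chain_at) (auto intro!: derivative_eq_intros)
    moreover have "(\<lambda>t. g (?w + \<i> * of_real t)) \<circ> (\<lambda>t. t - y) = h x"
      unfolding h_def o_def by (intro ext arg_cong[where f = g]) (simp add: complex_eq_iff)
    ultimately show ?thesis
      by (auto simp: has_vector_derivative_def intro: has_derivative_at_withinI)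
  qed
  have cont: "continuous (at (Re z, Im z) within X \<times> Y)
      (\<lambda>(x, y). blinfun_scaleR_left (partial_y g (of_real x + \<i> * of_real y)))"
  proof -
    have "continuous_on S (partial_y g)"
      using C1 by (simp add: C1_plane_on_def)
    then have "continuous_on (X \<times> Y) (\<lambda>p. partial_y g (of_real (fst p) + \<i> * of_real (snd p)))"
      by (rule continuous_on_compose2) (use XY in \<open>auto intro!: continuous_intros\<close>)
    then have "continuous_on (X \<times> Y)
        (\<lambda>p. blinfun_scaleR_left (partial_y g (of_real (fst p) + \<i> * of_real (snd p))))"
      by (rule bounded_linear.continuous_on[OF bounded_linear_blinfun_scaleR_left])
    then show ?thesis
      using zXY by (auto simp: continuous_on_eq_continuous_within case_prod_unfold)
  qed
  have "((\<lambda>(x, y). h x y) has_derivative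
      (\<lambda>(tx, ty). tx *\<^sub>R partial_x g z + blinfun_apply (blinfun_scaleR_left
        (partial_y g (of_real (Re z) + \<i> * of_real (Im z)))) ty)) (at (Re z, Im z) within X \<times> Y)"
    by (rule has_derivative_partialsI[OF hx hy cont]) (use zXY in \<open>auto simp: Y_def\<close>)
  moreover have "at (Re z, Im z) within X \<times> Y = at (Re z, Im z)"
    by (rule at_within_open) (use zXY in \<open>auto simp: X_def Y_def intro!: open_Times\<close>)
  ultimately have D: "((\<lambda>(x, y). h x y) has_derivative
      (\<lambda>(tx, ty). tx *\<^sub>R partial_x g z + ty *\<^sub>R partial_y g z)) (at (Re z, Im z))"
    by (simp only: z_eq blinfun_scaleR_left.rep_eq)
  have pd: "((\<lambda>w. (Re w, Im w)) has_derivative (\<lambda>w. (Re w, Im w))) (at z)"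
    by (intro bounded_linear_imp_has_derivative bounded_linear_Pair bounded_linear_Re bounded_linear_Im)
  have "((\<lambda>w. case (Re w, Im w) of (x, y) \<Rightarrow> h x y) has_derivative
     (\<lambda>w. case (Re w, Im w) of (tx, ty) \<Rightarrow> tx *\<^sub>R partial_x g z + ty *\<^sub>R partial_y g z)) (at z)"
    by (rule has_derivative_compose[OF pd D])
  moreover have "of_real (Re w) + \<i> * of_real (Im w) = w" for w by (simp add: complex_eq_iff)
  ultimately have D': "(g has_derivative (\<lambda>w. Re w *\<^sub>R partial_x g z + Im w *\<^sub>R partial_y g z)) (at z)"
    by (simp add: h_def)
  have "partial_x g z + \<i> * partial_y g z = 0"
    using CR by (simp add: wirtinger_bar_def)
  then have px: "partial_x g z = - (\<i> * partial_y g z)"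
    by (rule eq_neg_iff_add_eq_0[THEN iffD2])
  have "wirtinger g z = partial_x g z"
    by (simp add: wirtinger_def px)
  moreover have "partial_y g z = \<i> * partial_x g z"
    by (simp add: px flip: mult.assoc)
  moreover have "Re w *\<^sub>R a + Im w *\<^sub>R (\<i> * a) = a * w" for a w :: complex
    by (simp add: complex_eq_iff)
  ultimately show ?thesis
    using D' by (simp add: has_field_derivative_def)
qed

text \<open>The direction \<open>a\<close> is kept general so that \<open>a = 1\<close> and
  \<open>a = \<i>\<close> yield both partial derivatives from one chain rule.\<close>

lemma vector_derivative_holomorphic_plus_cnj:
  assumes S: "open S" and F: "F holomorphic_on S" and G: "G holomorphic_on S"
    and f: "\<And>w. w \<in> S \<Longrightarrow> f w = F w + cnj (G w)" and z: "z \<in> S"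
  shows "((\<lambda>t::real. f (z + a * of_real t)) has_vector_derivative
           a * deriv F z + cnj (a * deriv G z)) (at 0)"
proof -
  have line: "((\<lambda>t::real. z + a * of_real t) has_vector_derivative a) (at 0)"
    by (auto intro!: derivative_eq_intros)
  have D: "((\<lambda>t. H (z + a * of_real t)) has_vector_derivative a * deriv H z) (at 0)"
    if "H holomorphic_on S" for H
    using field_vector_diff_chain_at[OF line, of H "deriv H z"]
      holomorphic_derivI[OF that S z, of UNIV] by (simp add: o_def)
  have "((\<lambda>t. F (z + a * of_real t) + cnj (G (z + a * of_real t))) has_vector_derivative
           a * deriv F z + cnj (a * deriv G z)) (at 0)"
    using D[OF F] has_vector_derivative_cnj[OF D[OF G]]
    by (intro has_vector_derivative_add)
  \<comment> \<open>The decomposition of \<open>f\<close> is known on \<open>S\<close> only, so the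
    derivative is transferred on the open set of parameters whose points lie in
    \<open>S\<close>.\<close>
  moreover have "open ((\<lambda>t::real. z + a * of_real t) -` S)"
    by (intro open_vimage[OF S] continuous_intros)
  ultimately show ?thesis
    by (rule has_vector_derivative_transform_within_open) (use z f in auto)
qed

lemma
  assumes "open S" "F holomorphic_on S" "G holomorphic_on S"
    and "\<And>w. w \<in> S \<Longrightarrow> f w = F w + cnj (G w)"
  shows C1_plane_on_holomorphic_plus_cnj: "C1_plane_on f S"
    and partial_x_holomorphic_plus_cnj: "z \<in> S \<Longrightarrow> partial_x f z = deriv F z + cnj (deriv G z)"
    and partial_y_holomorphic_plus_cnj:
      "z \<in> S \<Longrightarrow> partial_y f z = \<i> * deriv F z + cnj (\<i> * deriv G z)"
proof -
  have D: "((\<lambda>t::real. f (z + a * of_real t)) has_vector_derivative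
      a * deriv F z + cnj (a * deriv G z)) (at 0)" if "z \<in> S" for z a
    using assms that by (rule vector_derivative_holomorphic_plus_cnj)
  show x: "partial_x f z = deriv F z + cnj (deriv G z)" if "z \<in> S" for z
    using D[OF that, of 1] by (simp add: partial_x_def vector_derivative_at)
  show y: "partial_y f z = \<i> * deriv F z + cnj (\<i> * deriv G z)" if "z \<in> S" for z
    unfolding partial_y_def by (rule vector_derivative_at[OF D[OF that]])
  have "continuous_on S (deriv F)" "continuous_on S (deriv G)"
    using assms by (auto intro!: holomorphic_on_imp_continuous_on holomorphic_deriv)
  then have "continuous_on S (partial_x f)" "continuous_on S (partial_y f)"
    by (auto simp: x y cong: continuous_on_cong intro!: continuous_intros)
  moreover have "(\<lambda>t::real. f (z + of_real t)) differentiable (at 0)"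
    and "(\<lambda>t::real. f (z + \<i> * of_real t)) differentiable (at 0)" if "z \<in> S" for z
    using D[OF that, of 1] D[OF that, of \<i>] by (auto simp: differentiableI_vector)
  ultimately show "C1_plane_on f S"
    by (auto simp: C1_plane_on_def)
qed

lemma
  assumes S: "open S" "F holomorphic_on S" "G holomorphic_on S"
    and f: "\<And>w. w \<in> S \<Longrightarrow> f w = F w + cnj (G w)" and z: "z \<in> S"
  shows wirtinger_holomorphic_plus_cnj: "wirtinger f z = deriv F z"
    and wirtinger_bar_holomorphic_plus_cnj: "wirtinger_bar f z = cnj (deriv G z)"
  unfolding wirtinger_def wirtinger_bar_def
    partial_x_holomorphic_plus_cnj[OF assms, simplified] partial_y_holomorphic_plus_cnj[OF assms, simplified]
  by (simp_all add: algebra_simps)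

text \<open>Both partial derivatives are again sums of a holomorphic and an antiholomorphic
  function, so first-order smoothness can be applied twice. The Laplace equation holds because
  \<open>wirtinger_bar f\<close> is antiholomorphic.\<close>

lemma harmonic_on_holomorphic_plus_cnj:
  assumes S: "open S" and F: "F holomorphic_on S" and G: "G holomorphic_on S"
    and f: "\<And>w. w \<in> S \<Longrightarrow> f w = F w + cnj (G w)"
  shows "harmonic_on f S"
proof -
  note * = S F G f
  have F': "deriv F holomorphic_on S" and G': "deriv G holomorphic_on S"
    using S F G by (auto intro: holomorphic_deriv)
  have "C1_plane_on (partial_x f) S"
    by (rule C1_plane_on_holomorphic_plus_cnj[OF S F' G'])
       (simp add: partial_x_holomorphic_plus_cnj[OF *])
  moreover have "C1_plane_on (partial_y f) S"
    by (rule C1_plane_on_holomorphic_plus_cnj[of S "\<lambda>z. \<i> * deriv F z" "\<lambda>z. \<i> * deriv G z"])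
       (auto simp: partial_y_holomorphic_plus_cnj[OF *] S intro!: holomorphic_intros F' G')
  moreover have "wirtinger (wirtinger_bar f) z = 0" if "z \<in> S" for z
    using wirtinger_holomorphic_plus_cnj[OF S _ G' _ that, of "\<lambda>_. 0" "wirtinger_bar f"]
      wirtinger_bar_holomorphic_plus_cnj[OF *] by simp
  ultimately show ?thesis
    using C1_plane_on_holomorphic_plus_cnj[OF *] by (auto simp: harmonic_on_def C2_plane_on_def)
qed

text \<open>Conjugation turns the Laplace equation, \<open>wirtinger\<close> of
  \<open>wirtinger_bar f\<close> being zero, into the Cauchy-Riemann equation for the conjugate of
  \<open>wirtinger_bar f\<close>.\<close>

lemma
  assumes "C1_plane_on f S"
  shows C1_plane_on_cnj: "C1_plane_on (\<lambda>z. cnj (f z)) S"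
    and wirtinger_bar_cnj: "z \<in> S \<Longrightarrow> wirtinger_bar (\<lambda>z. cnj (f z)) z = cnj (wirtinger f z)"
proof -
  have dx: "((\<lambda>t::real. cnj (f (z + of_real t))) has_vector_derivative cnj (partial_x f z)) (at 0)"
    and dy: "((\<lambda>t::real. cnj (f (z + \<i> * of_real t))) has_vector_derivative cnj (partial_y f z)) (at 0)"
    if "z \<in> S" for z
    using C1_plane_on_has_vector_derivative[OF assms that]
    by (auto intro: has_vector_derivative_cnj)
  have px: "partial_x (\<lambda>z. cnj (f z)) z = cnj (partial_x f z)"
    and py: "partial_y (\<lambda>z. cnj (f z)) z = cnj (partial_y f z)" if "z \<in> S" for z
    using dx[OF that] dy[OF that]
    by (auto simp: vector_derivative_at partial_x_def[of "\<lambda>z. cnj (f z)"] partial_y_def[of "\<lambda>z. cnj (f z)"])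
  show "C1_plane_on (\<lambda>z. cnj (f z)) S"
    using assms dx dy unfolding C1_plane_on_def
    by (auto simp: px py cong: continuous_on_cong intro!: continuous_intros intro: differentiableI_vector)
  show "wirtinger_bar (\<lambda>z. cnj (f z)) z = cnj (wirtinger f z)" if "z \<in> S"
    using px[OF that] py[OF that] by (simp add: wirtinger_def wirtinger_bar_def)
qed

lemma C1_plane_on_diff:
  assumes f: "C1_plane_on f S" and g: "C1_plane_on g S"
  shows "C1_plane_on (\<lambda>z. f z - g z) S"
    and "z \<in> S \<Longrightarrow> wirtinger_bar (\<lambda>z. f z - g z) z = wirtinger_bar f z - wirtinger_bar g z"
proof -
  have dx: "((\<lambda>t::real. f (z + of_real t) - g (z + of_real t)) has_vector_derivative
      partial_x f z - partial_x g z) (at 0)"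
    and dy: "((\<lambda>t::real. f (z + \<i> * of_real t) - g (z + \<i> * of_real t)) has_vector_derivative
      partial_y f z - partial_y g z) (at 0)"
    if "z \<in> S" for z
    using C1_plane_on_has_vector_derivative[OF f that] C1_plane_on_has_vector_derivative[OF g that]
    by (auto intro: has_vector_derivative_diff)
  have px: "partial_x (\<lambda>z. f z - g z) z = partial_x f z - partial_x g z"
    and py: "partial_y (\<lambda>z. f z - g z) z = partial_y f z - partial_y g z" if "z \<in> S" for z
    using dx[OF that] dy[OF that]
    by (auto simp: vector_derivative_at partial_x_def[of "\<lambda>z. f z - g z"] partial_y_def[of "\<lambda>z. f z - g z"])
  show "C1_plane_on (\<lambda>z. f z - g z) S"
    using f g dx dy unfolding C1_plane_on_def
    by (auto simp: px py cong: continuous_on_cong intro!: continuous_intros intro: differentiableI_vector)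
  show "wirtinger_bar (\<lambda>z. f z - g z) z = wirtinger_bar f z - wirtinger_bar g z" if "z \<in> S"
    unfolding wirtinger_bar_def px[OF that] py[OF that]
    by (simp add: field_simps)
qed

lemma C1_plane_on_wirtinger_bar:
  assumes "C2_plane_on f S"
  shows "C1_plane_on (wirtinger_bar f) S"
proof -
  let ?u = "partial_x f" and ?v = "partial_y f"
  have C: "C1_plane_on ?u S" "C1_plane_on ?v S"
    using assms by (auto simp: C2_plane_on_def)
  have dx: "((\<lambda>t::real. wirtinger_bar f (z + of_real t)) has_vector_derivative
      (1/2) * (partial_x ?u z + \<i> * partial_x ?v z)) (at 0)"
    and dy: "((\<lambda>t::real. wirtinger_bar f (z + \<i> * of_real t)) has_vector_derivative
      (1/2) * (partial_y ?u z + \<i> * partial_y ?v z)) (at 0)"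
    if "z \<in> S" for z
    unfolding wirtinger_bar_def
    by (intro has_vector_derivative_mult_right has_vector_derivative_add
        C1_plane_on_has_vector_derivative[OF C(1) that] C1_plane_on_has_vector_derivative[OF C(2) that])+
  have px: "partial_x (wirtinger_bar f) z = (1/2) * (partial_x ?u z + \<i> * partial_x ?v z)"
    and py: "partial_y (wirtinger_bar f) z = (1/2) * (partial_y ?u z + \<i> * partial_y ?v z)"
    if "z \<in> S" for z
    using dx[OF that] dy[OF that]
    by (auto simp: vector_derivative_at partial_x_def[of "wirtinger_bar f"]
        partial_y_def[of "wirtinger_bar f"])
  show ?thesis
    unfolding C1_plane_on_def using C[unfolded C1_plane_on_def] dx dy
    by (auto simp: px py cong: continuous_on_cong intro!: continuous_intros intro: differentiableI_vector)
qed

text \<open>The conjugate \<open>g\<close> of \<open>wirtinger_bar f\<close> is holomorphic by the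
  Laplace equation, and convexity provides a primitive \<open>G\<close>. Subtracting
  \<open>cnj G\<close> from \<open>f\<close> removes its \<open>wirtinger_bar\<close>, so the
  remainder is holomorphic.\<close>

lemma harmonic_on_imp_holomorphic_plus_cnj:
  assumes S: "open S" "convex S" and f: "harmonic_on f S"
  obtains F G where "F holomorphic_on S" "G holomorphic_on S"
    "\<And>z. z \<in> S \<Longrightarrow> f z = F z + cnj (G z)"
proof -
  define g where "g = (\<lambda>z. cnj (wirtinger_bar f z))"
  have C2: "C2_plane_on f S" and L: "\<And>z. z \<in> S \<Longrightarrow> wirtinger (wirtinger_bar f) z = 0"
    using f by (auto simp: harmonic_on_def)
  have "C1_plane_on g S" "\<And>z. z \<in> S \<Longrightarrow> wirtinger_bar g z = 0"
    using C1_plane_on_cnj[OF C1_plane_on_wirtinger_bar[OF C2]]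
      wirtinger_bar_cnj[OF C1_plane_on_wirtinger_bar[OF C2]] L by (auto simp: g_def)
  then have "g holomorphic_on S"
    using C1_plane_on_Cauchy_Riemann[OF S(1)] holomorphic_on_open[OF S(1)] by blast
  then obtain G where "\<And>z. z \<in> S \<Longrightarrow> (G has_field_derivative g z) (at z within S)"
    using holomorphic_convex_primitive'[OF S(2,1)] by blast
  then have G: "\<And>z. z \<in> S \<Longrightarrow> (G has_field_derivative g z) (at z)"
    by (simp add: at_within_open[OF _ S(1)])
  then have Gh: "G holomorphic_on S"
    using holomorphic_on_open[OF S(1)] by blast
  have C1G: "C1_plane_on (\<lambda>z. cnj (G z)) S"
    by (rule C1_plane_on_holomorphic_plus_cnj[of S "\<lambda>_. 0" G]) (auto simp: S Gh)
  have C1f: "C1_plane_on f S" using C2 by (simp add: C2_plane_on_def)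
  define F where "F = (\<lambda>z. f z - cnj (G z))"
  have "wirtinger_bar (\<lambda>z. cnj (G z)) z = wirtinger_bar f z" if "z \<in> S" for z
    using wirtinger_bar_holomorphic_plus_cnj[of S "\<lambda>_. 0" G "\<lambda>z. cnj (G z)" z] S Gh that
      DERIV_imp_deriv[OF G[OF that]] by (simp add: g_def)
  then have "C1_plane_on F S" "\<And>z. z \<in> S \<Longrightarrow> wirtinger_bar F z = 0"
    using C1_plane_on_diff[OF C1f C1G] by (auto simp: F_def)
  then have "F holomorphic_on S"
    using C1_plane_on_Cauchy_Riemann[OF S(1)] holomorphic_on_open[OF S(1)] by blast
  then show ?thesis
    using Gh by (intro that[of F G]) (auto simp: F_def)
qed

subsection \<open>Fourier coefficients on circles and the Hardy norm\<close>

text \<open>This is Cauchy's formula for the derivative at \<open>0\<close>, written in the angle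
  variable.\<close>

lemma holomorphic_circle_first_coefficient:
  assumes F: "F holomorphic_on ball 0 1" and r: "0 < r" "r < 1"
  shows "((\<lambda>t. F (of_real r * cis t) * cis (- t)) has_integral
           of_real (2 * pi * r) * deriv F 0) {0..2 * pi}"
proof -
  have sub: "cball 0 r \<subseteq> (ball 0 1 :: complex set)" using r by auto
  have c: "continuous_on (cball 0 r) F"
    using F sub holomorphic_on_imp_continuous_on holomorphic_on_subset by blast
  have h: "F holomorphic_on ball 0 r"
    using F sub ball_subset_cball holomorphic_on_subset by blast
  have "((\<lambda>u. F u / u ^ 2) has_contour_integral 2 * of_real pi * \<i> * deriv F 0) (circlepath 0 r)"
    using has_contour_integral_integral[OF Cauchy_derivative_integral_circlepath(1)[OF c h, of 0]]
      Cauchy_contour_integral_circlepath_2[OF c h, of 0] r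
    by (simp add: power2_eq_square)
  then have "((\<lambda>t. F (r * cis t) / (r * cis t) ^ 2 * r * \<i> * cis t) has_integral
      2 * of_real pi * \<i> * deriv F 0) {0..2 * pi}"
    unfolding circlepath_def by (subst (asm) has_contour_integral_part_circlepath_iff) auto
  \<comment> \<open>The factor \<open>- \<i> * r\<close> cancels what remains of
    \<open>du / u^2\<close> on the circle besides \<open>cis (- t)\<close>.\<close>
  then have "((\<lambda>t. (- \<i> * of_real r) * (F (r * cis t) / (r * cis t) ^ 2 * r * \<i> * cis t)) has_integral
      (- \<i> * of_real r) * (2 * of_real pi * \<i> * deriv F 0)) {0..2 * pi}"
    by (rule has_integral_mult_right)
  moreover have "(- \<i> * of_real r) * (F (r * cis t) / (r * cis t) ^ 2 * r * \<i> * cis t)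
      = F (of_real r * cis t) * cis (- t)" for t
    using r by (simp add: field_simps power2_eq_square cis_inverse[symmetric])
  ultimately show ?thesis
    by (simp add: mult_ac)
qed

text \<open>Up to a constant, the integrand is \<open>F u du\<close> on the circle, so Cauchy's
  theorem applies.\<close>

lemma holomorphic_circle_negative_coefficient:
  assumes F: "F holomorphic_on ball 0 1" and r: "0 < r" "r < 1"
  shows "((\<lambda>t. F (of_real r * cis t) * cis t) has_integral 0) {0..2 * pi}"
proof -
  have "(F has_contour_integral 0) (circlepath 0 r)"
    by (rule Cauchy_theorem_convex_simple[OF F]) (use r in auto)
  then have "((\<lambda>t. F (r * cis t) * r * \<i> * cis t) has_integral 0) {0..2 * pi}"
    unfolding circlepath_def by (subst (asm) has_contour_integral_part_circlepath_iff) auto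
  then have "((\<lambda>t. (- \<i> / of_real r) * (F (r * cis t) * r * \<i> * cis t)) has_integral
      (- \<i> / of_real r) * 0) {0..2 * pi}"
    by (rule has_integral_mult_right)
  then show ?thesis
    using r by (simp add: mult_ac)
qed

text \<open>Dividing out the unimodular factor \<open>cis t\<close> leaves
  \<open>a + b * cis (-2 * t)\<close>. The doubled frequency runs through the circle twice, which
  does not change the average.\<close>

lemma hardy_norm_has_integral:
  "((\<lambda>t. cmod (a * cis t + b * cis (- t))) has_integral 2 * pi * hardy_norm (a, b)) {0..2 * pi}"
proof -
  define h where "h = (\<lambda>t. cmod (a + b * cis t))"
  define I where "I = integral {0..2 * pi} h"
  have N: "2 * pi * hardy_norm (a, b) = I"
    by (simp add: hardy_norm_def I_def h_def cis_conv_exp)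
  have per: "h (t + 2 * pi) = h t" for t
    by (simp add: h_def cis.code)
  have base: "(h has_integral I) {0..2 * pi}"
    unfolding I_def h_def by (intro integrable_integral integrable_continuous_real continuous_intros)
  have "(h \<circ> (+) (2 * pi) has_integral I) {0..2 * pi}"
    using base by (simp add: o_def per add.commute[of "2 * pi"])
  then have "(h has_integral I) {2 * pi..4 * pi}"
    by (simp add: has_integral_shift_Icc_real)
  with base have "(h has_integral I + I) {0..4 * pi}"
    by (rule has_integral_combine[rotated 2]) auto
  \<comment> \<open>The substitution \<open>4 * pi - 2 * t\<close> maps \<open>[0, 2 pi]\<close>
    onto two periods, and its Jacobian \<open>1/2\<close> brings \<open>I + I\<close> back to
    \<open>I\<close>.\<close>
  from has_integral_affinity[of h "I + I" 0 "4 * pi" "-2" "4 * pi"] this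
  have "((\<lambda>t. h (4 * pi - 2 * t)) has_integral I)
      ((\<lambda>x. - (x / 2) + 2 * pi) ` {0..4 * pi})"
    by (simp add: algebra_simps)
  moreover have "(\<lambda>x. - (x / 2) + 2 * pi) ` {0..4 * pi} = {0..2 * pi}"
    using image_affinity_atLeastAtMost[of "- 1 / 2" "2 * pi" 0 "4 * pi"] by simp
  moreover have "h (4 * pi - 2 * t) = cmod (a * cis t + b * cis (- t))" for t
  proof -
    have "cis (4 * pi - 2 * t) = cis (- t) * cis (- t)"
    proof -
      have "cis (4 * pi - 2 * t) = cis (2 * pi) * cis (2 * pi) * (cis (- t) * cis (- t))"
        by (simp only: cis_mult) (simp add: algebra_simps)
      then show ?thesis by simp
    qed
    then have "a * cis t + b * cis (- t) = cis t * (a + b * cis (4 * pi - 2 * t))"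
      by (simp add: algebra_simps cis_mult)
    then show ?thesis by (simp add: h_def norm_mult)
  qed
  ultimately show ?thesis by (simp add: N)
qed

text \<open>On the circle of radius \<open>r\<close> the Fourier coefficients of index
  \<open>1\<close> and \<open>-1\<close> are \<open>r\<close> times the Wirtinger derivatives at
  \<open>0\<close>. Since \<open>f\<close> is bounded by \<open>1\<close>, the estimate holds with a
  factor \<open>r\<close>, which disappears as \<open>r\<close> tends to \<open>1\<close>.\<close>

lemma hermitian_pairing_le_hardy_norm:
  assumes f: "harmonic_disc_map f"
  shows "cmod (hermitian_pairing (wirtinger f 0, wirtinger_bar f 0) \<eta>) \<le> hardy_norm \<eta>"
proof -
  have "harmonic_on f unit_disc" and f1: "\<And>z. z \<in> unit_disc \<Longrightarrow> cmod (f z) < 1"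
    using f by (auto simp: harmonic_disc_map_def image_subset_iff)
  then obtain F G where F: "F holomorphic_on unit_disc" and G: "G holomorphic_on unit_disc"
    and fFG: "\<And>z. z \<in> unit_disc \<Longrightarrow> f z = F z + cnj (G z)"
    using harmonic_on_imp_holomorphic_plus_cnj[of unit_disc f] by auto
  have d: "wirtinger f 0 = deriv F 0" "wirtinger_bar f 0 = cnj (deriv G 0)"
    using wirtinger_holomorphic_plus_cnj[OF open_ball F G fFG, of 0]
      wirtinger_bar_holomorphic_plus_cnj[OF open_ball F G fFG, of 0] by auto
  obtain a b where \<eta>: "\<eta> = (a, b)" by (cases \<eta>)
  define P where "P = hermitian_pairing (wirtinger f 0, wirtinger_bar f 0) \<eta>"
  have bound: "r * cmod P \<le> hardy_norm \<eta>" if r: "0 < r" "r < 1" for r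
  proof -
    let ?z = "\<lambda>t. of_real r * cis t"
    \<comment> \<open>Of the four terms, \<open>F\<close> against \<open>cis (- t)\<close> and
      \<open>cnj G\<close> against \<open>cis t\<close> give derivatives at \<open>0\<close>; the
      other two integrate to zero.\<close>
    have "((\<lambda>t. (F (?z t) * cis (- t) + cnj (G (?z t) * cis t)) * cnj a
          + (F (?z t) * cis t + cnj (G (?z t) * cis (- t))) * cnj b) has_integral
        (of_real (2 * pi * r) * deriv F 0 + cnj 0) * cnj a +
        (0 + cnj (of_real (2 * pi * r) * deriv G 0)) * cnj b) {0..2 * pi}"
      by (intro has_integral_add has_integral_mult_left has_integral_cnj[unfolded o_def, THEN iffD2]
          holomorphic_circle_first_coefficient holomorphic_circle_negative_coefficient F G r)
    also have "(\<lambda>t. (F (?z t) * cis (- t) + cnj (G (?z t) * cis t)) * cnj a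
          + (F (?z t) * cis t + cnj (G (?z t) * cis (- t))) * cnj b)
        = (\<lambda>t. f (?z t) * cnj (a * cis t + b * cis (- t)))"
      using r by (simp add: fFG norm_mult cis_cnj algebra_simps)
    also have "(of_real (2 * pi * r) * deriv F 0 + cnj 0) * cnj a +
        (0 + cnj (of_real (2 * pi * r) * deriv G 0)) * cnj b = of_real (2 * pi * r) * P"
      by (simp add: P_def \<eta> hermitian_pairing_def d algebra_simps)
    finally have I: "((\<lambda>t. f (?z t) * cnj (a * cis t + b * cis (- t))) has_integral
        of_real (2 * pi * r) * P) {0..2 * pi}" .
    have "cmod (integral {0..2 * pi} (\<lambda>t. f (?z t) * cnj (a * cis t + b * cis (- t))))
        \<le> integral {0..2 * pi} (\<lambda>t. cmod (a * cis t + b * cis (- t)))"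
    proof (rule integral_norm_bound_integral)
      show "cmod (f (?z t) * cnj (a * cis t + b * cis (- t))) \<le> cmod (a * cis t + b * cis (- t))" for t
        using f1[of "?z t"] r
        by (simp add: norm_mult mult_left_le_one_le del: complex_cnj_add complex_cnj_mult)
    qed (use I hardy_norm_has_integral in blast)+
    then have "cmod (of_real (2 * pi * r) * P) \<le> 2 * pi * hardy_norm (a, b)"
      unfolding integral_unique[OF I] integral_unique[OF hardy_norm_has_integral] .
    then show ?thesis
      using r by (simp add: \<eta> norm_mult)
  qed
  have "((\<lambda>r. r * cmod P) \<longlongrightarrow> 1 * cmod P) (at_left 1)"
    by (intro tendsto_intros)
  moreover have "\<forall>\<^sub>F r in at_left (1::real). r * cmod P \<le> hardy_norm \<eta>"
    using eventually_at_left_real[of 0 1] by (rule eventually_mono) (auto intro: bound)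
  ultimately show ?thesis
    unfolding P_def[symmetric] by (intro tendsto_upperbound[of _ _ "at_left 1"]) auto
qed

lemma hardy_dual_norm_le_oneI:
  assumes "harmonic_disc_map f"
  shows "hardy_dual_norm (wirtinger f 0, wirtinger_bar f 0) \<le> 1"
  unfolding hardy_dual_norm_def
  by (rule cSup_least[OF hardy_dual_norm_set(1)])
     (use hermitian_pairing_le_hardy_norm[OF assms] order_trans in blast)

subsection \<open>Harmonic maps with prescribed boundary values\<close>

abbreviation circle_measure :: "real measure" where
  "circle_measure \<equiv> lebesgue_on {0..2 * pi}"

text \<open>The Bochner integral admits merely measurable boundary functions and gives access to
  dominated convergence and termwise integration.\<close>

definition circle_mean :: "(real \<Rightarrow> 'a) \<Rightarrow> 'a::{banach, second_countable_topology}" where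
  "circle_mean f = (1 / (2 * pi)) *\<^sub>R (\<integral>t. f t \<partial>circle_measure)"

lemma borel_measurable_circle_measure [intro]:
  "f \<in> borel_measurable borel \<Longrightarrow> f \<in> borel_measurable circle_measure"
  by (intro measurable_restrict_space1 measurable_completion) simp

lemma integrable_circle_measure:
  fixes f :: "real \<Rightarrow> 'a::{banach, second_countable_topology}"
  assumes "f \<in> borel_measurable circle_measure" "\<And>t. norm (f t) \<le> B"
  shows "integrable circle_measure f"
  by (rule finite_measure.integrable_const_bound[where B = B])
     (use assms in \<open>auto intro: finite_measure_lebesgue_on\<close>)

lemma circle_mean_const: "circle_mean (\<lambda>_. c) = c"
  by (simp add: circle_mean_def measure_restrict_space)

lemma circle_mean_eq_integral:
  fixes f :: "real \<Rightarrow> 'a::euclidean_space"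
  assumes "integrable circle_measure f"
  shows "circle_mean f = (1 / (2 * pi)) *\<^sub>R integral {0..2 * pi} f"
  using assms by (simp add: circle_mean_def lebesgue_integral_eq_integral)

lemma circle_mean_add:
  assumes "integrable circle_measure f" "integrable circle_measure g"
  shows "circle_mean (\<lambda>t. f t + g t) = circle_mean f + circle_mean g"
  using assms by (simp add: circle_mean_def scaleR_add_right)

lemma circle_mean_mult_right:
  fixes f :: "real \<Rightarrow> complex"
  shows "circle_mean (\<lambda>t. c * f t) = c * circle_mean f"
  unfolding circle_mean_def by (subst integral_mult_right_zero) simp

lemma circle_mean_cnj: "circle_mean (\<lambda>t. cnj (f t)) = cnj (circle_mean f)"
  by (simp add: circle_mean_def)

lemma circle_mean_Re: "integrable circle_measure f \<Longrightarrow> circle_mean (\<lambda>t. Re (f t)) = Re (circle_mean f)"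
  by (simp add: circle_mean_def)

lemma norm_circle_mean_le:
  assumes "integrable circle_measure f" "integrable circle_measure g" "\<And>t. norm (f t) \<le> g t"
  shows "norm (circle_mean f) \<le> circle_mean g"
proof -
  have "norm (\<integral>t. f t \<partial>circle_measure) \<le> (\<integral>t. g t \<partial>circle_measure)"
    by (rule Bochner_Integration.integral_norm_bound_integral) (use assms in auto)
  then show ?thesis by (simp add: circle_mean_def divide_right_mono)
qed

text \<open>If a boundary function on the circle has only odd frequencies, it has the form
  \<open>e\<^sup>i\<^sup>s \<phi>(-2s)\<close> for some \<open>\<phi>\<close>. Working with \<open>\<phi>\<close> and the variable \<open>z\<^sup>2\<close> turns the analytic
  part of its Poisson extension into \<open>z\<close> times the transform of \<open>\<phi>\<close> at \<open>z\<^sup>2\<close>, and makes the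
  extension vanish at \<open>0\<close>.\<close>

definition circle_transform :: "(real \<Rightarrow> complex) \<Rightarrow> complex \<Rightarrow> complex" where
  "circle_transform \<psi> w = circle_mean (\<lambda>t. \<psi> t / (1 - w * cis t))"

context
  fixes \<psi> :: "real \<Rightarrow> complex"
  assumes \<psi>: "\<psi> \<in> borel_measurable circle_measure" "\<And>t. cmod (\<psi> t) \<le> 1"
begin

lemma integrable_circle_transform:
  assumes w: "cmod w < 1"
  shows "integrable circle_measure (\<lambda>t. \<psi> t / (1 - w * cis t))"
proof (rule integrable_circle_measure)
  have "(\<lambda>t. 1 - w * cis t) \<in> borel_measurable borel"
    by (intro borel_measurable_continuous_onI continuous_intros)
  then have [measurable]: "(\<lambda>t. 1 - w * cis t) \<in> borel_measurable circle_measure" ..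
  note \<psi>(1) [measurable]
  show "(\<lambda>t. \<psi> t / (1 - w * cis t)) \<in> borel_measurable circle_measure"
    by measurable
  show "cmod (\<psi> t / (1 - w * cis t)) \<le> 1 / (1 - cmod w)" for t
  proof -
    have "1 - cmod w \<le> cmod (1 - w * cis t)"
      using norm_triangle_ineq2[of 1 "w * cis t"] by (simp add: norm_mult)
    then show ?thesis
      using w \<psi>(2)[of t] by (auto simp: norm_divide intro!: frac_le)
  qed
qed

text \<open>The kernel is expanded as a geometric series and integrated term by term, with
  \<open>cmod w ^ n\<close> as majorant. The resulting power series yields holomorphy.\<close>

lemma circle_transform_sums:
  assumes w: "cmod w < 1"
  shows "(\<lambda>n. circle_mean (\<lambda>t. \<psi> t * cis t ^ n) * w ^ n) sums circle_transform \<psi> w"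
proof -
  let ?f = "\<lambda>n t. \<psi> t * cis t ^ n * w ^ n"
  have le: "cmod (?f n t) \<le> cmod w ^ n" for n t
    using \<psi>(2)[of t] by (simp add: norm_mult norm_power mult_left_le_one_le)
  have meas: "?f n \<in> borel_measurable circle_measure" for n
  proof -
    have "(\<lambda>t. cis t ^ n * w ^ n) \<in> borel_measurable borel"
      by (intro borel_measurable_continuous_onI continuous_intros)
    then have [measurable]: "(\<lambda>t. cis t ^ n * w ^ n) \<in> borel_measurable circle_measure" ..
    note \<psi>(1) [measurable]
    have "(\<lambda>t. \<psi> t * (cis t ^ n * w ^ n)) \<in> borel_measurable circle_measure" by measurable
    then show ?thesis by (simp add: mult.assoc)
  qed
  have int: "integrable circle_measure (?f n)" for n
    using integrable_circle_measure[OF meas le] .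
  have geo: "summable (\<lambda>n. cmod w ^ n)" using w by (simp add: summable_geometric)
  have "(\<lambda>n. \<integral>t. ?f n t \<partial>circle_measure) sums (\<integral>t. (\<Sum>n. ?f n t) \<partial>circle_measure)"
  proof (rule sums_integral[OF int])
    show "AE t in circle_measure. summable (\<lambda>n. cmod (?f n t))"
      using le by (intro AE_I2 summable_comparison_test[OF _ geo]) auto
    show "summable (\<lambda>n. \<integral>t. cmod (?f n t) \<partial>circle_measure)"
    proof (rule summable_comparison_test)
      have "(\<integral>t. cmod (?f n t) \<partial>circle_measure) \<le> (\<integral>t. cmod w ^ n \<partial>circle_measure)" for n
        by (intro integral_mono integrable_norm int le integrable_circle_measure[of _ "cmod w ^ n"]) auto
      then show "\<exists>N. \<forall>n\<ge>N. norm (\<integral>t. cmod (?f n t) \<partial>circle_measure) \<le> 2 * pi * cmod w ^ n"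
        by (auto simp: measure_restrict_space)
      show "summable (\<lambda>n. 2 * pi * cmod w ^ n)" using geo by (intro summable_mult)
    qed
  qed
  moreover have "(\<Sum>n. ?f n t) = \<psi> t / (1 - w * cis t)" for t
  proof -
    have "(\<lambda>n. \<psi> t * (w * cis t) ^ n) sums (\<psi> t * (1 / (1 - w * cis t)))"
      by (intro sums_mult geometric_sums) (simp add: norm_mult w)
    then show ?thesis
      by (simp add: sums_iff power_mult_distrib mult_ac)
  qed
  ultimately have "(\<lambda>n. \<integral>t. ?f n t \<partial>circle_measure) sums (\<integral>t. \<psi> t / (1 - w * cis t) \<partial>circle_measure)"
    by simp
  then have "(\<lambda>n. (1 / (2 * pi)) *\<^sub>R (\<integral>t. ?f n t \<partial>circle_measure)) sums circle_transform \<psi> w"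
    unfolding circle_transform_def circle_mean_def by (rule sums_scaleR_right)
  then show ?thesis
    by (simp add: circle_mean_def)
qed

lemma circle_transform_holomorphic: "circle_transform \<psi> holomorphic_on ball 0 1"
  by (rule power_series_holomorphic) (use circle_transform_sums in simp)

lemma circle_transform_0: "circle_transform \<psi> 0 = circle_mean \<psi>"
  by (simp add: circle_transform_def)

end

text \<open>The kernel is \<open>1\<close> plus a term containing only positive frequencies, whose
  mean vanishes by Cauchy's theorem. This evaluates exactly the mean of the kernel that later
  dominates the harmonic map.\<close>

lemma circle_transform_one:
  assumes w: "cmod w < 1"
  shows "circle_transform (\<lambda>_. 1) w = 1"
proof -
  have nz: "1 - w * cis t \<noteq> 0" for t
  proof
    assume "1 - w * cis t = 0"
    then have "cmod (w * cis t) = 1" by (metis diff_eq_diff_eq diff_self norm_one)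
    with w show False by (simp add: norm_mult)
  qed
  define r where "r = (1 + cmod w) / 2"
  have r: "0 < r" "r < 1" "cmod w < r" using w by (auto simp: r_def intro: add_pos_nonneg)
  \<comment> \<open>Rescaling by \<open>r\<close>, chosen strictly between \<open>cmod w\<close> and
    \<open>1\<close>, keeps \<open>H\<close> holomorphic on the whole unit disc, while at
    \<open>r * cis t\<close> it takes the value \<open>w / (1 - w * cis t)\<close>.\<close>
  define H where "H = (\<lambda>u. w / (1 - (w / of_real r) * u))"
  have "H holomorphic_on ball 0 1"
    unfolding H_def
  proof (intro holomorphic_intros)
    fix u :: complex assume "u \<in> ball 0 1"
    then have "cmod (w / of_real r * u) < 1"
      using r mult_strict_mono'[of "cmod w" r "cmod u" 1] by (simp add: norm_mult norm_divide divide_less_eq)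
    then show "1 - (w / of_real r) * u \<noteq> 0" by auto
  qed
  from holomorphic_circle_negative_coefficient[OF this r(1,2)] r(1)
  have "((\<lambda>t. w / (1 - w * cis t) * cis t) has_integral 0) {0..2 * pi}"
    by (simp add: H_def)
  from has_integral_add[OF has_integral_const_real[of 1 0 "2 * pi"] this]
  have "((\<lambda>t. 1 + w / (1 - w * cis t) * cis t) has_integral of_real (2 * pi)) {0..2 * pi}"
    by (simp add: scaleR_conv_of_real)
  also have "(\<lambda>t. 1 + w / (1 - w * cis t) * cis t) = (\<lambda>t. 1 / (1 - w * cis t))"
    using nz by (simp add: field_simps)
  finally have "integral {0..2 * pi} (\<lambda>t. 1 / (1 - w * cis t)) = of_real (2 * pi)"
    by (rule integral_unique)
  then show ?thesis
    unfolding circle_transform_def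
    using circle_mean_eq_integral[OF integrable_circle_transform[OF _ _ w, of "\<lambda>_. 1"]]
    by (simp add: scaleR_conv_of_real)
qed

text \<open>The real part is the Poisson kernel \<open>(1 - |Z|^2) / |1 - Z|^2\<close>, whose
  denominator is at most \<open>(1 + |Z|)^2\<close>.\<close>

lemma Re_Cayley_ge:
  assumes Z: "cmod Z < 1"
  shows "Re ((1 + Z) / (1 - Z)) \<ge> (1 - cmod Z) / (1 + cmod Z)"
proof -
  have nz: "1 - Z \<noteq> 0" using Z by auto
  have "(1 + Z) / (1 - Z) = (1 + Z) * cnj (1 - Z) / of_real ((cmod (1 - Z))\<^sup>2)"
    by (rule complex_div_cnj)
  also have "Re \<dots> = (1 - (cmod Z)\<^sup>2) / (cmod (1 - Z))\<^sup>2"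
    unfolding Re_divide_of_real cmod_power2[of Z]
    by (simp add: power2_eq_square algebra_simps)
  finally have eq: "Re ((1 + Z) / (1 - Z)) = (1 - (cmod Z)\<^sup>2) / (cmod (1 - Z))\<^sup>2" .
  have "cmod (1 - Z) \<le> 1 + cmod Z" using norm_triangle_ineq4[of 1 Z] by simp
  then have "(cmod (1 - Z))\<^sup>2 \<le> (1 + cmod Z)\<^sup>2" by (intro power_mono) auto
  moreover have "(cmod Z)\<^sup>2 \<le> 1" using Z by (simp add: power_le_one)
  ultimately have "(1 - (cmod Z)\<^sup>2) / (1 + cmod Z)\<^sup>2 \<le> (1 - (cmod Z)\<^sup>2) / (cmod (1 - Z))\<^sup>2"
    using nz by (intro divide_left_mono) (auto intro!: mult_pos_pos add_pos_nonneg)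
  moreover have "(1 - (cmod Z)\<^sup>2) / (1 + cmod Z)\<^sup>2 = (1 - cmod Z) / (1 + cmod Z)"
  proof -
    have "1 + cmod Z \<noteq> 0" using norm_ge_zero[of Z] by linarith
    moreover have "1 - (cmod Z)\<^sup>2 = (1 - cmod Z) * (1 + cmod Z)"
      by (simp add: power2_eq_square algebra_simps)
    ultimately show ?thesis by (simp add: power2_eq_square)
  qed
  ultimately show ?thesis by (simp add: eq)
qed

text \<open>The left-hand side is half the difference of the Poisson kernels at \<open>Z\<close> and \<open>-Z\<close>, and the first
  term on the right is half their sum; both kernels are bounded below by positive constants.\<close>

lemma odd_Poisson_kernel_bound:
  assumes Z: "cmod Z < 1"
  shows "cmod (Z / (1 - Z\<^sup>2) + cnj (Z / (1 - Z\<^sup>2)))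
    \<le> Re (2 / (1 - Z\<^sup>2) - 1) - (1 - cmod Z) / (1 + cmod Z)"
proof -
  define u where "u = Z / (1 - Z\<^sup>2)"
  have nz: "1 - Z \<noteq> 0" "1 + Z \<noteq> 0" using Z by (auto simp: add_eq_0_iff)
  have fac: "1 - Z\<^sup>2 = (1 - Z) * (1 + Z)" by (simp add: power2_eq_square algebra_simps)
  have "2 / (1 - Z\<^sup>2) - 1 + 2 * u = (1 + Z) / (1 - Z)"
    and "2 / (1 - Z\<^sup>2) - 1 - 2 * u = (1 + (- Z)) / (1 - (- Z))"
    unfolding u_def fac using nz by (simp_all add: divide_simps, simp_all add: algebra_simps)
  then have "Re (2 / (1 - Z\<^sup>2) - 1 + 2 * u) \<ge> (1 - cmod Z) / (1 + cmod Z)"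
    and "Re (2 / (1 - Z\<^sup>2) - 1 - 2 * u) \<ge> (1 - cmod Z) / (1 + cmod Z)"
    using Re_Cayley_ge[of Z] Re_Cayley_ge[of "- Z"] Z by simp_all
  \<comment> \<open>The two lower bounds carry \<open>2 * u\<close> with opposite signs, so together
    they bound the absolute value of \<open>2 * Re u\<close>.\<close>
  moreover have "cmod (u + cnj u) = \<bar>2 * Re u\<bar>" by (simp add: complex_add_cnj)
  ultimately show ?thesis unfolding u_def[symmetric] by simp
qed

lemma deriv_mult_self_0:
  fixes g :: "complex \<Rightarrow> complex"
  assumes "g holomorphic_on ball 0 1"
  shows "deriv (\<lambda>z. z * g z) 0 = g 0"
proof -
  have "(g has_field_derivative deriv g 0) (at 0)"
    by (rule holomorphic_derivI[OF assms]) auto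
  then have "((\<lambda>z. z * g z) has_field_derivative g 0) (at 0)"
    by (auto intro!: derivative_eq_intros)
  then show ?thesis by (rule DERIV_imp_deriv)
qed

text \<open>The map is the mean of \<open>\<phi>\<close> against a kernel whose modulus is dominated
  by a function of mean strictly below \<open>1\<close>. Hence its values lie in the open disc even
  when \<open>\<phi>\<close> is unimodular. The Wirtinger derivatives at \<open>0\<close> come from
  the transforms at \<open>0\<close>.\<close>

lemma harmonic_disc_map_of_boundary:
  assumes \<phi>: "\<phi> \<in> borel_measurable circle_measure" "\<And>t. cmod (\<phi> t) \<le> 1"
  obtains f where "harmonic_disc_map f" "f 0 = 0" "wirtinger f 0 = circle_mean \<phi>"
    "wirtinger_bar f 0 = circle_mean (\<lambda>t. \<phi> t * cis (- t))"
proof -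
  \<comment> \<open>The factor \<open>cis t\<close> is chosen so that the conjugate of the mean of
    \<open>\<psi>\<close> is the second prescribed coefficient.\<close>
  define \<psi> where "\<psi> = (\<lambda>t. cnj (\<phi> t) * cis t)"
  have \<psi>: "\<psi> \<in> borel_measurable circle_measure" "\<And>t. cmod (\<psi> t) \<le> 1"
  proof -
    have "cis \<in> borel_measurable borel"
      by (intro borel_measurable_continuous_onI continuous_intros)
    then have [measurable]: "cis \<in> borel_measurable circle_measure" ..
    have "cnj \<in> borel_measurable borel"
      by (intro borel_measurable_continuous_onI continuous_intros)
    from measurable_compose[OF \<phi>(1) this]
    have [measurable]: "(\<lambda>t. cnj (\<phi> t)) \<in> borel_measurable circle_measure" .
    show "\<psi> \<in> borel_measurable circle_measure" unfolding \<psi>_def by measurable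
  qed (simp add: \<psi>_def norm_mult \<phi>)
  define F where "F = (\<lambda>z. z * circle_transform \<phi> (z\<^sup>2))"
  define G where "G = (\<lambda>z. z * circle_transform \<psi> (z\<^sup>2))"
  define f where "f = (\<lambda>z. F z + cnj (G z))"
  have sq: "cmod (z\<^sup>2) < 1" if "cmod z < 1" for z
    using that by (simp add: norm_power power_less_one_iff)
  have square: "power2 holomorphic_on unit_disc" "power2 ` unit_disc \<subseteq> unit_disc"
    using sq by (auto intro: holomorphic_intros)
  have T: "(\<lambda>z. circle_transform \<phi> (z\<^sup>2)) holomorphic_on unit_disc"
    "(\<lambda>z. circle_transform \<psi> (z\<^sup>2)) holomorphic_on unit_disc"
    using holomorphic_on_compose_gen[OF square(1) circle_transform_holomorphic[OF \<phi>] square(2)]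
      holomorphic_on_compose_gen[OF square(1) circle_transform_holomorphic[OF \<psi>] square(2)]
    by (simp_all add: o_def)
  have F: "F holomorphic_on unit_disc" and G: "G holomorphic_on unit_disc"
    unfolding F_def G_def by (intro holomorphic_intros T)+
  have bound: "cmod (f z) < 1" if z: "cmod z < 1" for z
  proof -
    \<comment> \<open>After rotation by \<open>e\<^sup>i\<^sup>t\<^sup>/\<^sup>2\<close>, the kernel \<open>Q\<close> becomes real.\<close>
    define Q where "Q = (\<lambda>t. z / (1 - z\<^sup>2 * cis t) + cnj (z * cis t / (1 - z\<^sup>2 * cis t)))"
    \<comment> \<open>This is the lower bound for the Poisson kernels at points of modulus
      \<open>cmod z\<close>; it provides the strict inequality.\<close>
    define \<delta> where "\<delta> = (1 - cmod z) / (1 + cmod z)"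
    have "\<delta> > 0" using z by (simp add: \<delta>_def add_pos_nonneg)
    note int = integrable_circle_transform[OF \<phi> sq[OF z]]
      integrable_circle_transform[OF \<psi> sq[OF z]]
    have "integrable circle_measure (\<lambda>t. z * (\<phi> t / (1 - z\<^sup>2 * cis t)) + cnj (z * (\<psi> t / (1 - z\<^sup>2 * cis t))))"
      by (intro Bochner_Integration.integrable_add integrable_mult_right integrable_cnj int)
    moreover have "f z = circle_mean (\<lambda>t. z * (\<phi> t / (1 - z\<^sup>2 * cis t)) + cnj (z * (\<psi> t / (1 - z\<^sup>2 * cis t))))"
      unfolding f_def F_def G_def circle_transform_def
        circle_mean_add[OF integrable_mult_right[OF int(1)] integrable_cnj[OF integrable_mult_right[OF int(2)]]]
        circle_mean_cnj circle_mean_mult_right ..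
    \<comment> \<open>Conjugating \<open>\<psi>\<close> restores \<open>\<phi>\<close>, so both
      summands share the factor \<open>\<phi> t\<close>.\<close>
    moreover have "(\<lambda>t. z * (\<phi> t / (1 - z\<^sup>2 * cis t)) + cnj (z * (\<psi> t / (1 - z\<^sup>2 * cis t)))) = (\<lambda>t. \<phi> t * Q t)"
      by (simp add: Q_def \<psi>_def algebra_simps)
    ultimately have intQ: "integrable circle_measure (\<lambda>t. \<phi> t * Q t)"
      and fQ: "f z = circle_mean (\<lambda>t. \<phi> t * Q t)" by simp_all
    have Q: "cmod (Q t) \<le> Re (2 * (1 / (1 - z\<^sup>2 * cis t)) - 1) - \<delta>" for t
    proof -
      define Z where "Z = z * cis (t / 2)"
      have Z2: "Z\<^sup>2 = z\<^sup>2 * cis t" by (simp add: Z_def power2_eq_square cis_mult mult_ac)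
      have "cis (t / 2) * cis (- t) = cis (- (t / 2))" by (simp add: cis_mult)
      then have "cis (t / 2) * Q t = Z / (1 - Z\<^sup>2) + cnj (Z / (1 - Z\<^sup>2))"
        unfolding Q_def Z2 by (simp add: Z_def algebra_simps cis_cnj)
      then have "cmod (Q t) = cmod (Z / (1 - Z\<^sup>2) + cnj (Z / (1 - Z\<^sup>2)))"
        by (metis mult_1 norm_cis norm_mult)
      also have "\<dots> \<le> Re (2 / (1 - Z\<^sup>2) - 1) - \<delta>"
        using odd_Poisson_kernel_bound[of Z] z by (simp add: Z_def norm_mult \<delta>_def)
      finally show ?thesis by (simp add: Z2)
    qed
    have int1: "integrable circle_measure (\<lambda>t. 1 / (1 - z\<^sup>2 * cis t))"
      using integrable_circle_transform[of "\<lambda>_. 1", OF _ _ sq[OF z]] by simp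
    have intc: "integrable circle_measure (\<lambda>_. - of_real (1 + \<delta>) :: complex)"
      by (rule integrable_circle_measure[OF _ order_refl]) simp
    have int2: "integrable circle_measure (\<lambda>t. 2 * (1 / (1 - z\<^sup>2 * cis t)) + - of_real (1 + \<delta>))"
      by (intro Bochner_Integration.integrable_add integrable_mult_right int1 intc)
    have "cmod (f z) \<le> circle_mean (\<lambda>t. Re (2 * (1 / (1 - z\<^sup>2 * cis t)) + - of_real (1 + \<delta>)))"
      unfolding fQ
    proof (rule norm_circle_mean_le[OF intQ integrable_Re[OF int2]])
      fix t
      have "cmod (\<phi> t * Q t) \<le> cmod (Q t)"
        using \<phi>(2)[of t] by (simp add: norm_mult mult_left_le_one_le)
      also note Q
      finally show "cmod (\<phi> t * Q t) \<le> Re (2 * (1 / (1 - z\<^sup>2 * cis t)) + - of_real (1 + \<delta>))"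
        by simp
    qed
    also have "\<dots> = Re (2 * circle_transform (\<lambda>_. 1) (z\<^sup>2) - of_real (1 + \<delta>))"
      unfolding circle_mean_Re[OF int2] circle_mean_add[OF integrable_mult_right[OF int1] intc]
        circle_mean_mult_right circle_mean_const circle_transform_def by simp
    \<comment> \<open>The transform of the constant \<open>1\<close> equals \<open>1\<close>, which
      leaves \<open>2 - (1 + \<delta>)\<close>.\<close>
    also have "\<dots> = 1 - \<delta>"
      by (simp add: circle_transform_one sq[OF z])
    finally show ?thesis using \<open>\<delta> > 0\<close> by simp
  qed
  show ?thesis
  proof (rule that)
    show "harmonic_disc_map f"
      using harmonic_on_holomorphic_plus_cnj[OF open_ball F G] bound
      by (auto simp: harmonic_disc_map_def f_def)
    show "f 0 = 0" by (simp add: f_def F_def G_def)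
    show "wirtinger f 0 = circle_mean \<phi>"
      using wirtinger_holomorphic_plus_cnj[OF open_ball F G, of f 0] deriv_mult_self_0[OF T(1)]
      by (simp add: f_def F_def[symmetric] circle_transform_0[OF \<phi>])
    have "circle_mean (\<lambda>t. \<phi> t * cis (- t)) = cnj (circle_mean \<psi>)"
      unfolding circle_mean_cnj[symmetric] by (simp add: \<psi>_def cis_cnj)
    then show "wirtinger_bar f 0 = circle_mean (\<lambda>t. \<phi> t * cis (- t))"
      using wirtinger_bar_holomorphic_plus_cnj[OF open_ball F G, of f 0] deriv_mult_self_0[OF T(2)]
      by (simp add: f_def G_def[symmetric] circle_transform_0[OF \<psi>])
  qed
qed

subsection \<open>Extremal vectors for the dual norm\<close>

lemma hardy_norm_eq_circle_mean: "hardy_norm (a, b) = circle_mean (\<lambda>t. cmod (a + b * cis t))"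
  and integrable_circle_cmod: "integrable circle_measure (\<lambda>t. cmod (a + b * cis t))"
proof -
  have "(\<lambda>t. cmod (a + b * cis t)) \<in> borel_measurable borel"
    by (intro borel_measurable_continuous_onI continuous_intros)
  then show *: "integrable circle_measure (\<lambda>t. cmod (a + b * cis t))"
    by (intro integrable_circle_measure[where B = "cmod a + cmod b"])
       (auto intro!: order_trans[OF norm_triangle_ineq] simp: norm_mult)
  show "hardy_norm (a, b) = circle_mean (\<lambda>t. cmod (a + b * cis t))"
    using circle_mean_eq_integral[OF *] by (simp add: hardy_norm_def cis_conv_exp)
qed

section \<open>Norm properties and continuity of the Hardy norm\<close>

lemma circle_mean_mono:
  fixes f g :: "real \<Rightarrow> real"
  assumes "integrable circle_measure f" "integrable circle_measure g" "\<And>t. f t \<le> g t"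
  shows "circle_mean f \<le> circle_mean g"
  using assms by (auto simp: circle_mean_def intro!: divide_right_mono integral_mono)

lemma hardy_norm_scaleR: "hardy_norm (r *\<^sub>R \<eta>) = \<bar>r\<bar> * hardy_norm \<eta>"
proof -
  obtain a b where \<eta>: "\<eta> = (a, b)" by (cases \<eta>)
  have "r *\<^sub>R a + r *\<^sub>R b * cis t = r *\<^sub>R (a + b * cis t)" for t
    by (simp add: scaleR_add_right)
  then show ?thesis
    by (simp add: \<eta> hardy_norm_eq_circle_mean circle_mean_def)
qed

lemma hardy_norm_triangle: "hardy_norm (\<eta> + \<zeta>) \<le> hardy_norm \<eta> + hardy_norm \<zeta>"
proof -
  obtain a b c d where eqs: "\<eta> = (a, b)" "\<zeta> = (c, d)" by (cases \<eta>, cases \<zeta>)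
  have "circle_mean (\<lambda>t. cmod ((a + c) + (b + d) * cis t))
      \<le> circle_mean (\<lambda>t. cmod (a + b * cis t) + cmod (c + d * cis t))"
  proof (rule circle_mean_mono)
    show "cmod ((a + c) + (b + d) * cis t) \<le> cmod (a + b * cis t) + cmod (c + d * cis t)" for t
      using norm_triangle_ineq[of "a + b * cis t" "c + d * cis t"] by (simp add: algebra_simps)
  qed (intro Bochner_Integration.integrable_add integrable_circle_cmod)+
  then show ?thesis
    by (simp add: eqs hardy_norm_eq_circle_mean circle_mean_add integrable_circle_cmod)
qed

lemma hardy_norm_le: "hardy_norm \<eta> \<le> cmod (fst \<eta>) + cmod (snd \<eta>)"
proof -
  have "circle_mean (\<lambda>t. cmod (fst \<eta> + snd \<eta> * cis t)) \<le> circle_mean (\<lambda>_. cmod (fst \<eta>) + cmod (snd \<eta>))"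
  proof (rule circle_mean_mono)
    show "cmod (fst \<eta> + snd \<eta> * cis t) \<le> cmod (fst \<eta>) + cmod (snd \<eta>)" for t
      using norm_triangle_ineq[of "fst \<eta>" "snd \<eta> * cis t"] by (simp add: norm_mult)
    show "integrable circle_measure (\<lambda>_. cmod (fst \<eta>) + cmod (snd \<eta>))"
      by (rule integrable_circle_measure) auto
  qed (rule integrable_circle_cmod)
  then show ?thesis
    using hardy_norm_eq_circle_mean[of "fst \<eta>" "snd \<eta>"] by (simp add: circle_mean_const)
qed

text \<open>The reverse triangle inequality and \<open>hardy_norm_le\<close> give a Lipschitz
  estimate. Continuity makes the unit ball closed.\<close>

lemma continuous_on_hardy_norm: "continuous_on UNIV hardy_norm"
proof -
  have "(hardy_norm \<longlongrightarrow> hardy_norm \<eta>) (at \<eta>)" for \<eta>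
  proof (rule LIM_zero_cancel)
    show "((\<lambda>\<zeta>. hardy_norm \<zeta> - hardy_norm \<eta>) \<longlongrightarrow> 0) (at \<eta>)"
    proof (rule Lim_null_comparison[OF always_eventually[OF allI]])
      fix \<zeta>
      have "\<bar>hardy_norm \<zeta> - hardy_norm \<eta>\<bar> \<le> hardy_norm (\<zeta> - \<eta>)"
        using hardy_norm_triangle[of "\<zeta> - \<eta>" \<eta>] hardy_norm_triangle[of "\<eta> - \<zeta>" \<zeta>]
          hardy_norm_scaleR[of "-1" "\<zeta> - \<eta>"] by simp
      also note hardy_norm_le
      finally show "norm (hardy_norm \<zeta> - hardy_norm \<eta>) \<le> cmod (fst (\<zeta> - \<eta>)) + cmod (snd (\<zeta> - \<eta>))"
        by simp
      show "((\<lambda>\<zeta>. cmod (fst (\<zeta> - \<eta>)) + cmod (snd (\<zeta> - \<eta>))) \<longlongrightarrow> 0) (at \<eta>)"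
        by (auto intro!: tendsto_eq_intros)
    qed
  qed
  then show ?thesis by (simp add: continuous_on_def)
qed

text \<open>Two zeros differ by a multiple of \<open>2 * pi\<close>, so the zero set is countable.
  Away from it the modulus is differentiable.\<close>

lemma AE_circle_affine_neq_0:
  assumes "(a, b) \<noteq> (0, 0)"
  shows "AE t in circle_measure. a + b * cis t \<noteq> 0"
proof -
  have "countable {t. a + b * cis t = 0}"
  proof (cases "\<exists>s. a + b * cis s = 0")
    case True
    then obtain s where s: "a + b * cis s = 0" by blast
    have "{t. a + b * cis t = 0} \<subseteq> range (\<lambda>n::int. s + 2 * pi * of_int n)"
    proof
      fix t assume "t \<in> {t. a + b * cis t = 0}"
      then have "b * cis t = b * cis s"
        using s by (simp add: add_eq_0_iff)
      moreover have "b \<noteq> 0" using s assms by auto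
      ultimately have "cis t = cis s" by simp
      then have "sin t = sin s \<and> cos t = cos s" by (simp add: complex_eq_iff)
      then show "t \<in> range (\<lambda>n::int. s + 2 * pi * of_int n)"
        by (auto simp: sin_cos_eq_iff)
    qed
    then show ?thesis by (rule countable_subset) simp
  qed auto
  then have "AE t in lebesgue. t \<notin> {t. a + b * cis t = 0}"
    by (intro AE_not_in null_sets_completionI countable_imp_null_set_lborel)
  then show ?thesis
    by (subst AE_restrict_space_iff) auto
qed

text \<open>The norm has derivative \<open>sgn w\<close> at a nonzero point \<open>w\<close>. The
  limit is taken along a sequence so that dominated convergence can be applied afterwards.\<close>

lemma norm_add_scaleR_difference_quotient:
  fixes w u :: complex
  assumes "w \<noteq> 0"
  shows "(\<lambda>n. (cmod (w + (1 / real (Suc n)) *\<^sub>R u) - cmod w) / (1 / real (Suc n))) \<longlonglongrightarrow> sgn w \<bullet> u"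
proof -
  have "((\<lambda>h. w + h *\<^sub>R u) has_derivative (\<lambda>h. h *\<^sub>R u)) (at 0)"
    by (auto intro!: derivative_eq_intros)
  moreover have "(norm has_derivative (\<lambda>h. sgn w \<bullet> h)) (at (w + 0 *\<^sub>R u))"
    using has_derivative_norm[OF assms] by (simp add: inner_commute)
  ultimately have "((\<lambda>h. cmod (w + h *\<^sub>R u)) has_derivative (\<lambda>h. sgn w \<bullet> (h *\<^sub>R u))) (at 0)"
    by (rule has_derivative_compose)
  then have "((\<lambda>h. cmod (w + h *\<^sub>R u)) has_field_derivative sgn w \<bullet> u) (at 0)"
    by (simp add: has_field_derivative_def mult_commute_abs)
  then have "((\<lambda>h. (cmod (w + h *\<^sub>R u) - cmod w) / h) \<longlongrightarrow> sgn w \<bullet> u) (at 0)"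
    by (simp add: has_field_derivative_iff)
  moreover have "filterlim (\<lambda>n. 1 / real (Suc n)) (at 0) sequentially"
    unfolding filterlim_at using LIMSEQ_inverse_real_of_nat by (simp add: inverse_eq_divide)
  ultimately show ?thesis
    by (rule filterlim_compose)
qed

text \<open>The quotients under the integral converge almost everywhere and, by the reverse triangle
  inequality, are dominated by \<open>cmod (c + d * cis t)\<close>.\<close>

lemma hardy_norm_difference_quotient:
  assumes "(a, b) \<noteq> (0, 0)"
  shows "(\<lambda>n. (hardy_norm ((a, b) + (1 / real (Suc n)) *\<^sub>R (c, d)) - hardy_norm (a, b)) / (1 / real (Suc n)))
    \<longlonglongrightarrow> circle_mean (\<lambda>t. sgn (a + b * cis t) \<bullet> (c + d * cis t))"
proof -
  let ?w = "\<lambda>t. a + b * cis t" and ?u = "\<lambda>t. c + d * cis t" and ?h = "\<lambda>n. 1 / real (Suc n)"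
  let ?s = "\<lambda>n t. (cmod (?w t + ?h n *\<^sub>R ?u t) - cmod (?w t)) / ?h n"
  have shift: "?w t + r *\<^sub>R ?u t = (a + r *\<^sub>R c) + (b + r *\<^sub>R d) * cis t" for r t
    by (simp add: algebra_simps)
  have int: "integrable circle_measure (\<lambda>t. cmod (?w t + r *\<^sub>R ?u t))" for r
    unfolding shift by (rule integrable_circle_cmod)
  have "(\<lambda>t. sgn (?w t)) \<in> borel_measurable borel" and "?u \<in> borel_measurable borel"
    by (intro borel_measurable_continuous_onI continuous_intros
        measurable_compose[OF _ borel_measurable_sgn])+
  then have lim_meas: "(\<lambda>t. sgn (?w t) \<bullet> ?u t) \<in> borel_measurable circle_measure"
    by (intro borel_measurable_inner) auto
  have "(\<lambda>n. \<integral>t. ?s n t \<partial>circle_measure) \<longlonglongrightarrow> (\<integral>t. sgn (?w t) \<bullet> ?u t \<partial>circle_measure)"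
  proof (rule integral_dominated_convergence)
    show "integrable circle_measure (\<lambda>t. cmod (?u t))" by (rule integrable_circle_cmod)
    show "AE t in circle_measure. (\<lambda>n. ?s n t) \<longlonglongrightarrow> sgn (?w t) \<bullet> ?u t"
      using AE_circle_affine_neq_0[OF assms]
      by (rule eventually_mono) (rule norm_add_scaleR_difference_quotient)
    show "?s n \<in> borel_measurable circle_measure" for n
      by (intro borel_measurable_integrable Bochner_Integration.integrable_diff
          integrable_divide int integrable_circle_cmod)
    show "AE t in circle_measure. norm (?s n t) \<le> cmod (?u t)" for n
    proof (rule AE_I2)
      fix t
      have "\<bar>cmod (?w t + ?h n *\<^sub>R ?u t) - cmod (?w t)\<bar> \<le> ?h n * cmod (?u t)"
        using norm_triangle_ineq3[of "?w t + ?h n *\<^sub>R ?u t" "?w t"] by simp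
      then have "\<bar>cmod (?w t + ?h n *\<^sub>R ?u t) - cmod (?w t)\<bar> / ?h n \<le> cmod (?u t)"
        by (subst pos_divide_le_eq) (simp_all only: zero_less_divide_1_iff of_nat_0_less_iff zero_less_Suc mult.commute)
      then show "norm (?s n t) \<le> cmod (?u t)" by (simp only: real_norm_def abs_divide abs_of_nat abs_one)
    qed
  qed (rule lim_meas)
  then have "(\<lambda>n. circle_mean (?s n)) \<longlonglongrightarrow> circle_mean (\<lambda>t. sgn (?w t) \<bullet> ?u t)"
    unfolding circle_mean_def by (intro tendsto_intros)
  moreover have "circle_mean (?s n)
      = (hardy_norm ((a, b) + ?h n *\<^sub>R (c, d)) - hardy_norm (a, b)) / ?h n" for n
    using int[of "?h n"] integrable_circle_cmod[of a b]
    by (simp add: hardy_norm_eq_circle_mean circle_mean_def shift[symmetric] left_diff_distrib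
        diff_divide_distrib)
  ultimately show ?thesis by simp
qed

text \<open>This replaces the complex pairing by the real inner product, so that the extremal
  problem concerns a real linear functional.\<close>

lemma Re_hermitian_pairing_eq_inner: "Re (hermitian_pairing \<xi> \<eta>) = \<xi> \<bullet> \<eta>"
  by (simp add: hermitian_pairing_def inner_prod_def inner_complex_def)

lemma inner_le_hardy_dual_norm:
  assumes "hardy_norm \<eta> \<le> 1"
  shows "\<xi> \<bullet> \<eta> \<le> hardy_dual_norm \<xi>"
proof -
  have "\<xi> \<bullet> \<eta> \<le> cmod (hermitian_pairing \<xi> \<eta>)"
    unfolding Re_hermitian_pairing_eq_inner[symmetric] by (rule complex_Re_le_cmod)
  also have "\<dots> \<le> hardy_dual_norm \<xi>"
    unfolding hardy_dual_norm_def
    by (rule cSup_upper[OF _ hardy_dual_norm_set(2)]) (use assms in blast)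
  finally show ?thesis .
qed

section \<open>Attainment of the maximum over the unit ball of the Hardy norm\<close>

lemma cmod_fst_le_hardy_norm: "cmod (fst \<eta>) \<le> hardy_norm \<eta>"
  and cmod_snd_le_hardy_norm: "cmod (snd \<eta>) \<le> hardy_norm \<eta>"
  using cmod_le_hardy_norm(1)[of "fst \<eta>" "snd \<eta>"] cmod_le_hardy_norm(2)[of "snd \<eta>" "fst \<eta>"]
  by simp_all

lemma hardy_norm_eq_0D: "hardy_norm \<eta> = 0 \<Longrightarrow> \<eta> = 0"
  using cmod_fst_le_hardy_norm[of \<eta>] cmod_snd_le_hardy_norm[of \<eta>] by (simp add: prod_eq_iff)

lemma hardy_norm_nonneg: "0 \<le> hardy_norm \<eta>"
  using norm_ge_zero cmod_fst_le_hardy_norm by (rule order_trans)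

text \<open>The unit ball is closed and, since the norm controls both coordinates, bounded; a
  continuous functional attains its maximum there. Homogeneity extends the inequality to all
  vectors.\<close>

lemma hardy_dual_norm_extremal:
  obtains \<eta> where "hardy_norm \<eta> \<le> 1" "\<And>v. \<xi> \<bullet> v \<le> (\<xi> \<bullet> \<eta>) * hardy_norm v"
proof -
  define K where "K = {\<eta>. hardy_norm \<eta> \<le> 1}"
  have "K \<subseteq> cball 0 1 \<times> cball 0 1"
  proof
    fix \<eta> assume "\<eta> \<in> K"
    then show "\<eta> \<in> cball 0 1 \<times> cball 0 1"
      using cmod_fst_le_hardy_norm[of \<eta>] cmod_snd_le_hardy_norm[of \<eta>]
      by (auto simp: K_def mem_Times_iff)
  qed
  then have "K = (cball 0 1 \<times> cball 0 1) \<inter> K" by blast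
  moreover have "closed K"
    unfolding K_def using continuous_on_hardy_norm by (intro closed_Collect_le continuous_intros)
  ultimately have "compact K"
    by (metis compact_Int_closed compact_Times compact_cball)
  moreover have K0: "0 \<in> K"
    using hardy_norm_scaleR[of 0 0] by (simp add: K_def)
  moreover have "continuous_on K (\<lambda>\<eta>. \<xi> \<bullet> \<eta>)" by (intro continuous_intros)
  ultimately obtain \<eta> where \<eta>: "\<eta> \<in> K" "\<And>v. v \<in> K \<Longrightarrow> \<xi> \<bullet> v \<le> \<xi> \<bullet> \<eta>"
    using continuous_attains_sup[of K "\<lambda>\<eta>. \<xi> \<bullet> \<eta>"] by blast
  have "\<xi> \<bullet> v \<le> (\<xi> \<bullet> \<eta>) * hardy_norm v" for v
  proof (cases "hardy_norm v = 0")
    case True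
    then show ?thesis using hardy_norm_eq_0D[OF True] by simp
  next
    case False
    then have pos: "hardy_norm v > 0" using hardy_norm_nonneg[of v] by linarith
    then have "(1 / hardy_norm v) *\<^sub>R v \<in> K"
      by (simp add: K_def hardy_norm_scaleR)
    from \<eta>(2)[OF this] show ?thesis
      using pos by (simp add: field_simps)
  qed
  then show ?thesis using \<eta>(1) that by (auto simp: K_def)
qed

lemma integrable_circle_bounded_mult_cis:
  assumes \<phi>: "\<phi> \<in> borel_measurable circle_measure" "\<And>t. cmod (\<phi> t) \<le> 1"
  shows "integrable circle_measure \<phi>" "integrable circle_measure (\<lambda>t. \<phi> t * cis (- t))"
proof -
  show "integrable circle_measure \<phi>" using \<phi> by (rule integrable_circle_measure)
  have "(\<lambda>t. cis (- t)) \<in> borel_measurable borel"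
    by (intro borel_measurable_continuous_onI continuous_intros)
  then have [measurable]: "(\<lambda>t. cis (- t)) \<in> borel_measurable circle_measure" ..
  note \<phi>(1) [measurable]
  show "integrable circle_measure (\<lambda>t. \<phi> t * cis (- t))"
    by (rule integrable_circle_measure[where B = 1]) (simp_all add: norm_mult \<phi>(2))
qed

text \<open>For the real inner product, multiplication by \<open>cis t\<close> on one side moves to
  multiplication by \<open>cis (- t)\<close> on the other. The directional derivative of the Hardy
  norm thereby becomes an inner product with Fourier coefficients.\<close>

lemma circle_mean_inner_affine:
  assumes \<phi>: "\<phi> \<in> borel_measurable circle_measure" "\<And>t. cmod (\<phi> t) \<le> 1"
  shows "circle_mean (\<lambda>t. \<phi> t \<bullet> (c + d * cis t))
    = (circle_mean \<phi>, circle_mean (\<lambda>t. \<phi> t * cis (- t))) \<bullet> (c, d)"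
proof -
  note int = integrable_circle_bounded_mult_cis[OF \<phi>]
  have "\<phi> t \<bullet> (c + d * cis t) = \<phi> t \<bullet> c + (\<phi> t * cis (- t)) \<bullet> d" for t
    by (simp add: inner_complex_def algebra_simps)
  then show ?thesis
    using int by (simp add: circle_mean_def inner_prod_def add_divide_distrib)
qed

text \<open>The extremal inequality along \<open>\<eta> + h *\<^sub>R v\<close>, divided by
  \<open>h > 0\<close> in the limit, bounds \<open>\<xi> \<bullet> v\<close> by
  \<open>m * (\<mu> \<bullet> v)\<close> for every \<open>v\<close>. A linear functional bounded
  above by another linear functional equals it.\<close>

lemma hardy_dual_norm_le_one_imp_harmonic_disc_map:
  assumes "hardy_dual_norm (\<alpha>, \<beta>) \<le> 1"
  obtains f where "harmonic_disc_map f" "f 0 = 0" "wirtinger f 0 = \<alpha>" "wirtinger_bar f 0 = \<beta>"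
proof -
  define \<xi> where "\<xi> = (\<alpha>, \<beta>)"
  have "\<exists>\<phi>. \<phi> \<in> borel_measurable circle_measure \<and> (\<forall>t. cmod (\<phi> t) \<le> 1) \<and>
      circle_mean \<phi> = \<alpha> \<and> circle_mean (\<lambda>t. \<phi> t * cis (- t)) = \<beta>"
  proof (cases "\<xi> = 0")
    case True
    then show ?thesis
      by (intro exI[of _ "\<lambda>_. 0"]) (auto simp: \<xi>_def circle_mean_const zero_prod_def)
  next
    case False
    obtain \<eta> where \<eta>: "hardy_norm \<eta> \<le> 1" and ext: "\<And>v. \<xi> \<bullet> v \<le> (\<xi> \<bullet> \<eta>) * hardy_norm v"
      using hardy_dual_norm_extremal[of \<xi>] by blast
    define m where "m = \<xi> \<bullet> \<eta>"
    \<comment> \<open>Testing the extremal inequality with \<open>\<xi>\<close> itself shows that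
      \<open>m\<close> is positive, which in turn forces \<open>\<eta>\<close> to be
      nonzero.\<close>
    have "0 < \<xi> \<bullet> \<xi>" using False by simp
    also have "\<dots> \<le> m * hardy_norm \<xi>" unfolding m_def by (rule ext)
    finally have m0: "0 < m"
      using hardy_norm_nonneg[of \<xi>] by (auto simp: zero_less_mult_iff)
    have m1: "m \<le> 1"
      using inner_le_hardy_dual_norm[OF \<eta>, of \<xi>] assms by (simp add: m_def \<xi>_def)
    \<comment> \<open>This permits replacing \<open>m\<close> by
      \<open>m * hardy_norm \<eta>\<close> when the difference quotient is formed.\<close>
    have \<eta>m: "m * hardy_norm \<eta> \<le> m" using \<eta> m0 by simp
    obtain a b where ab: "\<eta> = (a, b)" by (cases \<eta>)
    have nz: "(a, b) \<noteq> (0, 0)" using m0 by (auto simp: m_def ab simp flip: zero_prod_def)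
    let ?s = "\<lambda>t. sgn (a + b * cis t)"
    have "?s \<in> borel_measurable borel"
      by (intro borel_measurable_continuous_onI continuous_intros
          measurable_compose[OF _ borel_measurable_sgn])
    then have s: "?s \<in> borel_measurable circle_measure" "\<And>t. cmod (?s t) \<le> 1"
      by (auto simp: norm_sgn)
    define \<mu> where "\<mu> = (circle_mean ?s, circle_mean (\<lambda>t. ?s t * cis (- t)))"
    have "\<xi> \<bullet> v \<le> m * (\<mu> \<bullet> v)" for v
    proof -
      obtain c d where v: "v = (c, d)" by (cases v)
      have "\<xi> \<bullet> v \<le> m * circle_mean (\<lambda>t. ?s t \<bullet> (c + d * cis t))"
      proof (rule LIMSEQ_le_const)
        show "(\<lambda>n. m * ((hardy_norm ((a, b) + (1 / real (Suc n)) *\<^sub>R (c, d)) - hardy_norm (a, b))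
            / (1 / real (Suc n)))) \<longlonglongrightarrow> m * circle_mean (\<lambda>t. ?s t \<bullet> (c + d * cis t))"
          by (intro tendsto_mult_left hardy_norm_difference_quotient nz)
        show "\<exists>N. \<forall>n\<ge>N. \<xi> \<bullet> v \<le> m * ((hardy_norm ((a, b) + (1 / real (Suc n)) *\<^sub>R (c, d))
            - hardy_norm (a, b)) / (1 / real (Suc n)))"
        proof (intro exI allI impI)
          fix n :: nat
          define h where "h = 1 / real (Suc n)"
          have "h > 0" by (simp add: h_def)
          have "m + h * (\<xi> \<bullet> v) = \<xi> \<bullet> (\<eta> + h *\<^sub>R v)"
            by (simp add: m_def inner_add_right)
          also have "\<dots> \<le> m * hardy_norm (\<eta> + h *\<^sub>R v)" unfolding m_def by (rule ext)
          finally have "h * (\<xi> \<bullet> v) \<le> m * (hardy_norm (\<eta> + h *\<^sub>R v) - hardy_norm \<eta>)"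
            using \<eta>m by (simp add: right_diff_distrib)
          then have "\<xi> \<bullet> v \<le> m * ((hardy_norm (\<eta> + h *\<^sub>R v) - hardy_norm \<eta>) / h)"
            using \<open>h > 0\<close> by (simp add: field_simps)
          then show "\<xi> \<bullet> v \<le> m * ((hardy_norm ((a, b) + (1 / real (Suc n)) *\<^sub>R (c, d))
            - hardy_norm (a, b)) / (1 / real (Suc n)))"
            unfolding ab v h_def .
        qed
      qed
      then show ?thesis
        using circle_mean_inner_affine[OF s] by (simp add: \<mu>_def v)
    qed
    \<comment> \<open>Taking the difference of the two functionals as test vector gives its squared
      norm on one side and zero on the other.\<close>
    from this[of "\<xi> - m *\<^sub>R \<mu>"] have "(\<xi> - m *\<^sub>R \<mu>) \<bullet> (\<xi> - m *\<^sub>R \<mu>) \<le> 0"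
      by (simp add: inner_diff_left)
    then have "\<xi> = m *\<^sub>R \<mu>"
      by (metis inner_gt_zero_iff not_less right_minus_eq)
    then have "\<alpha> = m *\<^sub>R circle_mean ?s" "\<beta> = m *\<^sub>R circle_mean (\<lambda>t. ?s t * cis (- t))"
      by (simp_all add: \<xi>_def \<mu>_def)
    moreover have "(\<lambda>t. m *\<^sub>R ?s t) \<in> borel_measurable circle_measure"
      using s(1) by (intro borel_measurable_scaleR) auto
    moreover have "cmod (m *\<^sub>R ?s t) \<le> 1" for t
      using m0 m1 s(2)[of t] by (simp add: mult_le_one)
    ultimately show ?thesis
      \<comment> \<open>The factor \<open>m\<close> from the gradient identity is absorbed into the
        boundary function; \<open>m \<le> 1\<close> keeps its modulus at most
        \<open>1\<close>.\<close>
      by (intro exI[of _ "\<lambda>t. m *\<^sub>R ?s t"]) (simp add: circle_mean_def)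
  qed
  then obtain \<phi> where \<phi>: "\<phi> \<in> borel_measurable circle_measure" "\<And>t. cmod (\<phi> t) \<le> 1"
    and coeffs: "circle_mean \<phi> = \<alpha>" "circle_mean (\<lambda>t. \<phi> t * cis (- t)) = \<beta>"
    by blast
  from harmonic_disc_map_of_boundary[OF \<phi>] show ?thesis
    using that coeffs by metis
qed

theorem theorem4p1:
  fixes \<alpha> \<beta> :: complex
  shows "((\<exists>f. harmonic_disc_map f \<and> f 0 = 0 \<and> wirtinger f 0 = \<alpha> \<and> wirtinger_bar f 0 = \<beta>)
          \<longleftrightarrow> (\<exists>f. harmonic_disc_map f \<and> wirtinger f 0 = \<alpha> \<and> wirtinger_bar f 0 = \<beta>))
       \<and> ((\<exists>f. harmonic_disc_map f \<and> wirtinger f 0 = \<alpha> \<and> wirtinger_bar f 0 = \<beta>)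
          \<longleftrightarrow> hardy_dual_norm (\<alpha>, \<beta>) \<le> 1)"
  using hardy_dual_norm_le_oneI hardy_dual_norm_le_one_imp_harmonic_disc_map[of \<alpha> \<beta>] by metis

end
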